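(* Let $D$ be a chord diagram and let $D_a$ be the diagram obtained from $D$ by amalgamating all maximal fans. Then the braid indices of $D$ and of $D_a$ are the same.
   Context: An $n$-diagram (chord diagram) is an oriented circle with $2n$ distinct marked points partitioned into $n$ pairs (the chords), up to orientation-preserving homeomorphism. A word on $m$ strands is a word $W=A(i_1,j_1)\cdots A(i_n,j_n)$ in symbols $A(i,j)$, $1\le i<j\le m$, where $A(i,j)$ is viewed as a horizontal chord joining strands $i$ and $j$ of the identity $m$-braid, the letters being placed from top to bottom. Its closure is the $n$-diagram obtained by joining the bottom of strand $k$ to the top of strand $k+1$ ($k<m$) and the bottom of strand $m$ to the top of strand $1$; i.e. the cyclic sequence of chord labels around the circle is $L_1L_2\cdots L_m$, where $L_k$ is the increasing sequence of those $r$ with $k\in\{i_r,j_r\}$. The braid index of $D$ is the least $m$ such that $D$ is the closure of a word on $m$ strands. A fan $F$ in $D$ is a (nonempty) collection of chords such that (i) every chord in $F$ crosses every other chord in $F$, and (ii) there are two disjoint arcs $\alpha_1,\alpha_2$ on the circle of $D$ such that each chord in $F$ has one endpoint in each arc and no other chord of $D$ has an endpoint in $\alpha_1$ or $\alpha_2$. A maximal fan is a fan not contained in any other fan; every chord lies in a unique maximal fan (possibly consisting of that chord alone). Amalgamating a fan $F$ means replacing the chords of $F$ by a single chord (with one endpoint in each of $\alpha_1,\alpha_2$), weighted by the number of chords in $F$. $D_a$ is the result of amalgamating all maximal fans of $D$; for the braid index of $D_a$ the weights are ignored. *)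

theory Defs
  imports Main
begin

text \<open>
  A chord diagram is represented by the sequence of chord labels read off along the
  oriented circle from some base point, so every label occurs exactly twice. Two such words
  give the same diagram (up to orientation-preserving homeomorphism) iff they differ by a
  change of base point and a renaming of the chords.
\<close>

definition chord_diagram :: "'a list \<Rightarrow> bool" where
  "chord_diagram D \<longleftrightarrow> (\<forall>c\<in>set D. count_list D c = 2)"

definition same_diagram :: "'a list \<Rightarrow> 'b list \<Rightarrow> bool" where
  "same_diagram D E \<longleftrightarrow> (\<exists>k f. inj_on f (set D) \<and> E = map f (rotate k D))"

text \<open>The pair \<open>(i, j)\<close> stands for the letter $A(i,j)$.\<close>

definition strand_word :: "nat \<Rightarrow> (nat \<times> nat) list \<Rightarrow> bool" where
  "strand_word m W \<longleftrightarrow> (\<forall>(i, j)\<in>set W. 1 \<le> i \<and> i < j \<and> j \<le> m)"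

definition strand_labels :: "(nat \<times> nat) list \<Rightarrow> nat \<Rightarrow> nat list" where
  "strand_labels W k = filter (\<lambda>r. k \<in> {fst (W ! r), snd (W ! r)}) [0..<length W]"

definition word_closure :: "nat \<Rightarrow> (nat \<times> nat) list \<Rightarrow> nat list" where
  "word_closure m W = concat (map (strand_labels W) [1..<Suc m])"

text \<open>
  The condition \<open>1 \<le> m\<close> matters only for the diagram without chords: with no strands the
  closure would not be a circle.
\<close>

definition braid_index :: "'a list \<Rightarrow> nat" where
  "braid_index D =
     (LEAST m. 1 \<le> m \<and> (\<exists>W. strand_word m W \<and> same_diagram D (word_closure m W)))"

definition crosses :: "'a list \<Rightarrow> 'a \<Rightarrow> 'a \<Rightarrow> bool" where
  "crosses D a b \<longleftrightarrow>
     a \<noteq> b \<and> filter (\<lambda>c. c = a \<or> c = b) D \<in> {[a, b, a, b], [b, a, b, a]}"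

text \<open>
  Disjoint arcs \<open>A1\<close>, \<open>A2\<close> of the circle: after a change of base point to the start of
  \<open>A1\<close>, both are contiguous and disjoint subwords.
\<close>

definition fan :: "'a list \<Rightarrow> 'a set \<Rightarrow> bool" where
  "fan D F \<longleftrightarrow>
     F \<noteq> {} \<and> F \<subseteq> set D \<and>
     (\<forall>a\<in>F. \<forall>b\<in>F. a \<noteq> b \<longrightarrow> crosses D a b) \<and>
     (\<exists>k A1 U A2 V. rotate k D = A1 @ U @ A2 @ V \<and>
        (\<forall>c\<in>F. count_list A1 c = 1 \<and> count_list A2 c = 1) \<and>
        set A1 \<subseteq> F \<and> set A2 \<subseteq> F)"

definition maximal_fan :: "'a list \<Rightarrow> 'a set \<Rightarrow> bool" where
  "maximal_fan D F \<longleftrightarrow> fan D F \<and> (\<forall>G. fan D G \<and> F \<subseteq> G \<longrightarrow> G = F)"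

text \<open>
  Amalgamating all maximal fans: the circle is cut into arcs, each containing exactly one
  endpoint of every chord of one maximal fan and nothing else. Every maximal fan \<open>F\<close> then
  occupies exactly two of these arcs, as each of its chords has two endpoints. Each arc is
  replaced by a single marked point labelled by \<open>F\<close>, so that \<open>F\<close> itself becomes one chord
  (its weight would be \<open>card F\<close>). The result \<open>E\<close> is a diagram only up to homeomorphism.
\<close>

definition amalgamation :: "'a list \<Rightarrow> 'b list \<Rightarrow> bool" where
  "amalgamation D E \<longleftrightarrow>
     (\<exists>k Bs. rotate k D = concat Bs \<and>
        (\<forall>B\<in>set Bs. distinct B \<and> maximal_fan D (set B)) \<and>
        same_diagram (map set Bs) E)"

end

theory Submission imports Defs begin

text \<open>
  A chord diagram is a closure on \<open>m\<close> strands iff its circle can be cut into \<open>m\<close> arcs along each of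
  which the chords increase in one common linear order. Such a cutting survives the deletion of
  chords, and also the replacement of a chord by a fan of parallel chords, which become consecutive
  in the order. Since all chords of a fan cross, they appear in the same order in both of its arcs,
  so amalgamation and its inverse are operations of these two kinds. This requires that a chord lies
  in only one maximal fan: seen from a common chord, two fans are common prefixes and suffixes of
  the two remaining arcs, and their union is again a fan.
\<close>

section \<open>Rotations\<close>

lemma rotate_split: obtains u v where "xs = u @ v" "rotate k xs = v @ u"
  by (metis append_take_drop_id rotate_drop_take)

lemma rotate_swap: "\<exists>k. v @ u = rotate k (u @ v)"
  by (metis rotate_append)

lemma rotate_inverse: "\<exists>j. rotate j (rotate k xs) = xs"
  by (metis rotate_split rotate_append)

lemma rotate_concat_map: "\<exists>j. concat (map g (rotate k xs)) = rotate j (concat (map g xs))"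
proof -
  obtain u v where "xs = u @ v" "rotate k xs = v @ u" by (rule rotate_split)
  then show ?thesis by (simp add: rotate_swap)
qed

lemma count_list_rotate: "count_list (rotate k xs) x = count_list xs x"
proof -
  obtain u v where "xs = u @ v" "rotate k xs = v @ u" by (rule rotate_split)
  then show ?thesis by simp
qed

lemma count_list_distinct: "distinct xs \<Longrightarrow> count_list xs x = (if x \<in> set xs then 1 else 0)"
  by (induction xs) auto

lemma distinct_if_count_list:
  assumes "\<And>x. x \<in> set xs \<Longrightarrow> count_list xs x = 1"
  shows "distinct xs"
  using assms
proof (induction xs)
  case (Cons x xs)
  have "x \<notin> set xs" using Cons.prems[of x] by (simp add: count_list_0_iff)
  moreover have "distinct xs" using Cons calculation by (metis count_list.simps(2) list.set_intros(2))
  ultimately show ?case by simp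
qed simp

section \<open>Cutting a cyclic word into increasing arcs\<close>

text \<open>
  The list \<open>xs\<close> records a linear order of the chords, namely the vertical order of the letters of
  a braid word; the arcs are the strands.
\<close>

definition cut_into :: "nat \<Rightarrow> 'a list \<Rightarrow> bool" where
  "cut_into m D \<longleftrightarrow> (\<exists>k Ss xs. rotate k D = concat Ss \<and> length Ss = m \<and> distinct xs \<and>
     (\<forall>S\<in>set Ss. \<exists>P. S = filter P xs))"

lemma cut_into_rotate: "cut_into m (rotate j D) \<longleftrightarrow> cut_into m D"
proof -
  have *: "cut_into m D" if "cut_into m (rotate j D)" for j and D :: "'a list"
    using that unfolding cut_into_def rotate_rotate by blast
  obtain i where "rotate i (rotate j D) = D"
    using rotate_inverse by blast
  then show ?thesis using * by metis
qed

section \<open>Substituting strings of new chords for chords\<close>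

lemma filter_concat_map:
  assumes "\<And>x y. x \<in> set xs \<Longrightarrow> y \<in> set (g x) \<Longrightarrow> Q y \<longleftrightarrow> P x"
  shows "filter Q (concat (map g xs)) = concat (map g (filter P xs))"
  using assms
proof (induction xs)
  case (Cons x xs)
  have "filter Q (g x) = (if P x then g x else [])"
    using Cons.prems[of x] by (auto simp: filter_empty_conv intro!: filter_True)
  then show ?case using Cons by simp
qed simp

lemma distinct_concat_map:
  assumes "distinct xs" "\<And>x. x \<in> set xs \<Longrightarrow> distinct (g x)"
    "\<And>x y. x \<in> set xs \<Longrightarrow> y \<in> set xs \<Longrightarrow> x \<noteq> y \<Longrightarrow> set (g x) \<inter> set (g y) = {}"
  shows "distinct (concat (map g xs))"
  using assms
proof (induction xs)
  case (Cons x xs)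
  have "distinct (concat (map g xs))"
    using Cons by (meson distinct.simps(2) list.set_intros(2))
  moreover have "set (g x) \<inter> set (g y) = {}" if "y \<in> set xs" for y
    using Cons.prems that by auto
  ultimately show ?case using Cons.prems(2)[of x] by auto
qed simp

text \<open>An entry of \<open>xs\<close> satisfies \<open>P\<close> iff it occurs in
  \<open>S\<close>. Hence membership can stand in for \<open>P\<close>, and the order can be cut
  down to the chords of a diagram.\<close>

lemma filter_restrict:
  assumes "S = filter P xs" "set S \<subseteq> X"
  shows "S = filter (\<lambda>x. x \<in> set S) (filter (\<lambda>x. x \<in> X) xs)"
proof -
  have "filter (\<lambda>x. x \<in> set S) (filter (\<lambda>x. x \<in> X) xs) = filter P xs"
    unfolding filter_filter using assms by (intro filter_cong) auto
  then show ?thesis using assms(1) by simp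
qed

text \<open>Substituting \<open>g x\<close> for \<open>x\<close> in the common order gives an order
  of the new chords. By disjointness a new chord determines the old one, so arcs stay filtered
  sublists. Empty strings delete chords, singletons rename them, longer strings make them
  parallel.\<close>

lemma cut_into_concat_map:
  assumes "cut_into m D" and dist: "\<And>x. x \<in> set D \<Longrightarrow> distinct (g x)"
    and disj: "\<And>x y. x \<in> set D \<Longrightarrow> y \<in> set D \<Longrightarrow> x \<noteq> y \<Longrightarrow> set (g x) \<inter> set (g y) = {}"
  shows "cut_into m (concat (map g D))"
proof -
  obtain k Ss xs where D: "rotate k D = concat Ss" and m: "length Ss = m" and xs: "distinct xs"
    and S: "\<And>S. S \<in> set Ss \<Longrightarrow> \<exists>P. S = filter P xs"
    using assms(1) unfolding cut_into_def by blast
  \<comment> \<open>The order \<open>xs\<close> may list labels outside \<open>D\<close>, about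
    which \<open>dist\<close> and \<open>disj\<close> say nothing.\<close>
  define ys where "ys = filter (\<lambda>x. x \<in> set D) xs"
  have sub: "set S \<subseteq> set D" if "S \<in> set Ss" for S
    using that arg_cong[OF D, of set] by auto
  have ys: "distinct (concat (map g ys))"
    by (rule distinct_concat_map) (use xs dist disj in \<open>auto simp: ys_def\<close>)
  have "\<exists>Q. concat (map g S) = filter Q (concat (map g ys))" if "S \<in> set Ss" for S
  proof -
    obtain P where P: "S = filter P xs" using S[OF \<open>S \<in> set Ss\<close>] ..
    have S_ys: "S = filter (\<lambda>x. x \<in> set S) ys"
      unfolding ys_def by (rule filter_restrict[OF P sub[OF that]])
    have "filter (\<lambda>y. \<exists>x\<in>set S. y \<in> set (g x)) (concat (map g ys))
        = concat (map g (filter (\<lambda>x. x \<in> set S) ys))"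
    proof (rule filter_concat_map)
      fix x y assume "x \<in> set ys" "y \<in> set (g x)"
      then show "(\<exists>x\<in>set S. y \<in> set (g x)) \<longleftrightarrow> x \<in> set S"
        using disj[of x] sub[OF that] unfolding ys_def by (auto simp: disjoint_iff)
    qed
    then show ?thesis unfolding S_ys[symmetric] by (intro exI) (rule sym)
  qed
  moreover obtain j where "rotate j (concat (map g D)) = concat (map g (concat Ss))"
    using rotate_concat_map[of g k D] unfolding D by metis
  moreover have "concat (map g (concat Ss)) = concat (map (\<lambda>S. concat (map g S)) Ss)"
    by (induction Ss) auto
  ultimately show ?thesis
    unfolding cut_into_def using m ys
    by (intro exI[of _ j] exI[of _ "map (\<lambda>S. concat (map g S)) Ss"] exI[of _ "concat (map g ys)"])
      (simp del: distinct_concat_iff)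
qed

text \<open>A renaming substitutes singletons; the converse uses the inverse renaming.\<close>

lemma cut_into_map:
  assumes "inj_on f (set D)"
  shows "cut_into m (map f D) \<longleftrightarrow> cut_into m D"
proof -
  have *: "cut_into m (map h E)" if "cut_into m E" "inj_on h (set E)" for h :: "'c \<Rightarrow> 'd" and E
    using cut_into_concat_map[OF that(1), of "\<lambda>x. [h x]"] that(2) by (simp add: inj_on_eq_iff)
  have "map (inv_into (set D) f) (map f D) = D"
    using assms by (simp add: map_idI)
  then show ?thesis
    using *[of D f] *[of "map f D" "inv_into (set D) f"] assms by (auto simp: inj_on_inv_into)
qed

section \<open>Closures of words as cuttings\<close>

lemma concat_filter_two:
  assumes "\<And>S. S \<in> set Ss \<Longrightarrow> distinct S" "count_list (concat Ss) c = 2"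
  obtains i j where "i < j" "j < length Ss"
    "\<And>l. l < length Ss \<Longrightarrow> c \<in> set (Ss ! l) \<longleftrightarrow> l = i \<or> l = j"
proof -
  \<comment> \<open>A distinct arc meets \<open>c\<close> at most once, so counting endpoints of
    \<open>c\<close> amounts to counting the arcs that contain it.\<close>
  have "count_list (concat Ss) c = length (filter (\<lambda>S. c \<in> set S) Ss)"
    using assms(1)
  proof (induction Ss)
    case (Cons S Ss)
    have "count_list S c = (if c \<in> set S then 1 else 0)"
      using Cons.prems[of S] by (simp add: count_list_distinct)
    then show ?case using Cons by simp
  qed simp
  then have "card {l. l < length Ss \<and> c \<in> set (Ss ! l)} = 2"
    using assms(2) by (simp add: length_filter_conv_card)
  then obtain i j where ij: "i \<noteq> j" "{l. l < length Ss \<and> c \<in> set (Ss ! l)} = {i, j}"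
    by (auto simp: card_2_iff)
  then have *: "l < length Ss \<and> c \<in> set (Ss ! l) \<longleftrightarrow> l = i \<or> l = j" for l
    by blast
  show thesis
  proof (cases "i < j")
    case True
    then show thesis using that[of i j] * by blast
  next
    case False
    then show thesis using that[of j i] * ij(1) by (metis linorder_neqE_nat)
  qed
qed

lemma word_closure_conv:
  assumes "length Ls = m" "\<And>l. l < m \<Longrightarrow> strand_labels W (Suc l) = Ls ! l"
  shows "word_closure m W = concat Ls"
proof -
  have "map (strand_labels W) [1..<Suc m] = Ls"
    using assms by (intro nth_equalityI) (simp_all del: upt_Suc)
  then show ?thesis by (simp only: word_closure_def)
qed

lemma cut_into_word_closure: "cut_into m (word_closure m W)"
  unfolding cut_into_def word_closure_def
  by (intro exI[of _ 0] exI[of _ "map (strand_labels W) [1..<Suc m]"] exI[of _ "[0..<length W]"])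
    (auto simp: strand_labels_def)

text \<open>A cutting yields a word: each chord becomes the letter joining the two arcs that contain
  it, and the letters follow the common order. The two arcs differ because every arc is
  distinct.\<close>

lemma closure_iff_cut_into:
  assumes "chord_diagram D"
  shows "(\<exists>W. strand_word m W \<and> same_diagram D (word_closure m W)) \<longleftrightarrow> cut_into m D"
proof
  assume "\<exists>W. strand_word m W \<and> same_diagram D (word_closure m W)"
  then obtain W k f where "inj_on f (set D)" "word_closure m W = map f (rotate k D)"
    unfolding same_diagram_def by blast
  then show "cut_into m D"
    using cut_into_word_closure[of m W] by (simp add: cut_into_map cut_into_rotate)
next
  assume "cut_into m D"
  then obtain k Ss xs where D: "rotate k D = concat Ss" and m: "length Ss = m" and xs: "distinct xs"
    and S: "\<And>S. S \<in> set Ss \<Longrightarrow> \<exists>P. S = filter P xs"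
    unfolding cut_into_def by blast
  define ys where "ys = filter (\<lambda>x. x \<in> set D) xs"
  have set_D: "set D = set (concat Ss)" using arg_cong[OF D, of set] by simp
  have "set D \<subseteq> set xs" unfolding set_D using S by fastforce
  then have ys: "distinct ys" "set ys = set D" using xs by (auto simp: ys_def)
  have S_ys: "S = filter (\<lambda>x. x \<in> set S) ys" if "S \<in> set Ss" for S
  proof -
    have "set S \<subseteq> set D" using that set_D by auto
    moreover obtain P where "S = filter P xs" using S[OF \<open>S \<in> set Ss\<close>] ..
    ultimately show ?thesis unfolding ys_def by (intro filter_restrict)
  qed
  have distS: "distinct S" if "S \<in> set Ss" for S
    by (subst S_ys[OF that]) (simp add: ys(1))
  have "\<exists>p. 1 \<le> fst p \<and> fst p < snd p \<and> snd p \<le> m \<and>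
      (\<forall>l<m. c \<in> set (Ss ! l) \<longleftrightarrow> Suc l \<in> {fst p, snd p})" if "c \<in> set D" for c
  proof -
    have "count_list (concat Ss) c = 2"
      using assms that unfolding chord_diagram_def D[symmetric] count_list_rotate by blast
    then obtain i j where "i < j" "j < length Ss"
      "\<And>l. l < length Ss \<Longrightarrow> c \<in> set (Ss ! l) \<longleftrightarrow> l = i \<or> l = j"
      using concat_filter_two[of Ss c] distS by blast
    \<comment> \<open>Arcs are numbered from 0, strands from 1.\<close>
    then show ?thesis using m by (intro exI[of _ "(Suc i, Suc j)"]) auto
  qed
  then obtain p where p: "\<And>c. c \<in> set D \<Longrightarrow> 1 \<le> fst (p c) \<and> fst (p c) < snd (p c) \<and> snd (p c) \<le> m \<and>
      (\<forall>l<m. c \<in> set (Ss ! l) \<longleftrightarrow> Suc l \<in> {fst (p c), snd (p c)})"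
    by metis
  define W where "W = map p ys"
  \<comment> \<open>\<open>L S\<close> is the arc \<open>S\<close> with each chord replaced by its
    position in \<open>ys\<close>, which is its label in the closure of \<open>W\<close>.\<close>
  define L where "L S = filter (\<lambda>r. ys ! r \<in> set S) [0..<length ys]" for S
  have W: "strand_word m W"
    unfolding strand_word_def W_def using p ys(2) by (auto simp: case_prod_unfold)
  have "strand_labels W (Suc l) = map L Ss ! l" if "l < m" for l
  proof -
    have "Suc l \<in> {fst (W ! r), snd (W ! r)} \<longleftrightarrow> ys ! r \<in> set (Ss ! l)" if "r < length ys" for r
      using p[of "ys ! r"] that \<open>l < m\<close> ys(2) by (metis W_def nth_map nth_mem)
    then have "strand_labels W (Suc l) = L (Ss ! l)"
      unfolding strand_labels_def L_def by (intro filter_cong) (simp_all add: W_def)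
    then show ?thesis using that m by simp
  qed
  then have closure: "word_closure m W = concat (map L Ss)"
    using m by (intro word_closure_conv) auto
  have "map ((!) ys) (L S) = S" if "S \<in> set Ss" for S
  proof -
    have "map ((!) ys) (L S) = filter (\<lambda>x. x \<in> set S) (map ((!) ys) [0..<length ys])"
      unfolding L_def filter_map o_def ..
    then show ?thesis using S_ys[OF that] by (simp add: map_nth)
  qed
  then have nth_closure: "map ((!) ys) (word_closure m W) = rotate k D"
    unfolding closure D map_concat map_map by (intro arg_cong[where f = concat] map_idI) simp
  have inj: "inj_on ((!) ys) {..<length ys}"
    using ys(1) by (simp add: inj_on_nth)
  \<comment> \<open>The renaming that \<open>same_diagram\<close> asks for sends a chord to its
    position in \<open>ys\<close>.\<close>
  define f where "f = inv_into {..<length ys} ((!) ys)"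
  have "set D \<subseteq> (!) ys ` {..<length ys}"
    unfolding ys(2)[symmetric] by (auto simp: set_conv_nth)
  then have "inj_on f (set D)" unfolding f_def by (rule inj_on_inv_into)
  moreover have "set (word_closure m W) \<subseteq> {..<length ys}"
    unfolding closure L_def by auto
  then have "map f (map ((!) ys) (word_closure m W)) = word_closure m W"
    unfolding map_map f_def using inj by (intro map_idI) (auto intro: inv_into_f_f)
  then have "word_closure m W = map f (rotate k D)" using nth_closure by simp
  ultimately show "\<exists>W. strand_word m W \<and> same_diagram D (word_closure m W)"
    using W unfolding same_diagram_def by blast
qed

lemma braid_index_conv:
  assumes "chord_diagram D"
  shows "braid_index D = (LEAST m. 1 \<le> m \<and> cut_into m D)"
  unfolding braid_index_def closure_iff_cut_into[OF assms] ..

section \<open>Fans\<close>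

text \<open>A change of base point shifts the alternating pattern of \<open>a\<close> and
  \<open>b\<close> cyclically, which keeps it alternating.\<close>

lemma crosses_rotate:
  assumes "crosses D a b"
  shows "crosses (rotate k D) a b"
proof -
  obtain u v where "D = u @ v" "rotate k D = v @ u" by (rule rotate_split)
  then show ?thesis
    using assms unfolding crosses_def by (auto simp: append_eq_Cons_conv)
qed

lemma filter_pair_distinct:
  assumes "distinct B" "a \<in> set B" "b \<in> set B" "a \<noteq> b"
  shows "filter (\<lambda>c. c = a \<or> c = b) B \<in> {[a, b], [b, a]}"
proof -
  have one: "filter (\<lambda>c. c = x) B = [x]" if "distinct B" "x \<in> set B" for x and B :: "'a list"
    using that by (induction B) (auto simp: filter_empty_conv)
  show ?thesis using assms
  proof (induction B)
    case (Cons x B)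
    consider "x = a" | "x = b" | "x \<noteq> a" "x \<noteq> b" by blast
    then show ?case
    proof cases
      case 1
      then have "filter (\<lambda>c. c = a \<or> c = b) B = filter (\<lambda>c. c = b) B"
        using Cons.prems by (intro filter_cong) auto
      then show ?thesis using 1 Cons.prems one[of B b] by auto
    next
      case 2
      then have "filter (\<lambda>c. c = a \<or> c = b) B = filter (\<lambda>c. c = a) B"
        using Cons.prems by (intro filter_cong) auto
      then show ?thesis using 2 Cons.prems one[of B a] by auto
    next
      case 3
      then show ?thesis using Cons by auto
    qed
  qed simp
qed

text \<open>Two different heads would form a pair that the lists order differently. So the heads
  agree, and induction applies to the tails.\<close>

lemma distinct_same_order_eq:
  assumes "distinct A" "distinct B" "set A = set B"
    "\<And>a b. a \<in> set A \<Longrightarrow> b \<in> set A \<Longrightarrow> a \<noteq> b \<Longrightarrow>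
       filter (\<lambda>c. c = a \<or> c = b) A = filter (\<lambda>c. c = a \<or> c = b) B"
  shows "A = B"
  using assms
proof (induction A arbitrary: B)
  case (Cons x A)
  obtain y B' where B: "B = y # B'" using Cons.prems(3) by (cases B) auto
  have xy: "x = y"
  proof (rule ccontr)
    assume "x \<noteq> y"
    moreover have "y \<in> set (x # A)" using Cons.prems(3) B by auto
    ultimately have "filter (\<lambda>c. c = x \<or> c = y) (x # A) = filter (\<lambda>c. c = x \<or> c = y) B"
      using Cons.prems(4)[of x y] by auto
    then show False using \<open>x \<noteq> y\<close> B by auto
  qed
  have "set A = set B'"
    using Cons.prems(1-3) B xy by auto
  moreover have "filter (\<lambda>c. c = a \<or> c = b) A = filter (\<lambda>c. c = a \<or> c = b) B'"
    if "a \<in> set A" "b \<in> set A" "a \<noteq> b" for a b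
    using Cons.prems(4)[of a b] that B xy by (auto split: if_splits)
  ultimately have "A = B'" using Cons.IH[of B'] Cons.prems(1,2) B by auto
  then show ?case using B xy by simp
qed simp

text \<open>Restricted to a crossing pair, the circle alternates and each arc reads
  \<open>[a, b]\<close> or \<open>[b, a]\<close>; alternation forces the same choice in both
  arcs.\<close>

lemma crossing_arcs_eq:
  assumes "rotate k D = X @ B @ Y @ B' @ Z" "distinct B" "distinct B'" "set B = set B'"
    and cross: "\<And>a b. a \<in> set B \<Longrightarrow> b \<in> set B \<Longrightarrow> a \<noteq> b \<Longrightarrow> crosses D a b"
  shows "B = B'"
proof (rule distinct_same_order_eq[OF assms(2-4)])
  fix a b assume ab: "a \<in> set B" "b \<in> set B" "a \<noteq> b"
  let ?f = "filter (\<lambda>c. c = a \<or> c = b)"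
  have all: "?f X @ ?f B @ ?f Y @ ?f B' @ ?f Z \<in> {[a, b, a, b], [b, a, b, a]}"
    using crosses_rotate[OF cross[OF ab], of k] assms(1) by (simp add: crosses_def)
  have 1: "?f B \<in> {[a, b], [b, a]}" using filter_pair_distinct[of B a b] assms ab by simp
  have 2: "?f B' \<in> {[a, b], [b, a]}" using filter_pair_distinct[of B' a b] assms ab by simp
  \<comment> \<open>The pair has four endpoints and the two arcs use them all, so \<open>X\<close>,
    \<open>Y\<close> and \<open>Z\<close> contain none.\<close>
  have "length (?f X @ ?f B @ ?f Y @ ?f B' @ ?f Z) = 4" using all by (elim insertE) (simp_all only: list.size, simp_all)
  moreover have "length (?f B) = 2" "length (?f B') = 2" using 1 2 by force+
  ultimately have "?f X = []" "?f Y = []" "?f Z = []" by (simp_all flip: length_0_conv)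
  then show "?f B = ?f B'" using all 1 2 ab(3) by auto
qed

text \<open>Normal form of a fan: both arcs list exactly \<open>F\<close>, and crossing forces one
  order, so a single word \<open>A\<close> is read twice.\<close>

lemma fan_decomp:
  assumes "fan D F"
  obtains k A U V where "rotate k D = A @ U @ A @ V" "set A = F"
proof -
  obtain k A1 U A2 V where D: "rotate k D = A1 @ U @ A2 @ V"
    and one: "\<And>c. c \<in> F \<Longrightarrow> count_list A1 c = 1 \<and> count_list A2 c = 1"
    and sub: "set A1 \<subseteq> F" "set A2 \<subseteq> F"
    using assms unfolding fan_def by blast
  have F: "set A1 = F" "set A2 = F"
    using one sub by (metis count_notin subsetI subset_antisym zero_neq_one)+
  have "A1 = A2"
    by (rule crossing_arcs_eq[of k D "[]" A1 U A2 V])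
      (use D F one assms in \<open>auto simp: fan_def intro: distinct_if_count_list\<close>)
  then show thesis using that D F by blast
qed

text \<open>Two copies of \<open>A\<close> use up both endpoints of each of its chords, so
  \<open>U\<close> and \<open>V\<close> contain none of them and any two chords of \<open>A\<close>
  alternate.\<close>

lemma fanI:
  assumes "chord_diagram D" "rotate k D = A @ U @ A @ V" "A \<noteq> []"
  shows "fan D (set A)"
proof -
  have cnt: "count_list (A @ U @ A @ V) c = 2" if "c \<in> set A" for c
  proof -
    have "c \<in> set D" using that arg_cong[OF assms(2), of set] by auto
    then show ?thesis using assms(1) by (simp flip: assms(2) add: count_list_rotate chord_diagram_def)
  qed
  have pos: "count_list A c \<ge> 1" if "c \<in> set A" for c
    using that count_list_0_iff[of A c] by linarith
  have one: "count_list A c = 1" "c \<notin> set U" "c \<notin> set V" if "c \<in> set A" for c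
    using cnt[OF that] pos[OF that] by (auto simp flip: count_list_0_iff)
  have "distinct A"
    using one(1) by (rule distinct_if_count_list)
  have "crosses D a b" if ab: "a \<in> set A" "b \<in> set A" "a \<noteq> b" for a b
  proof -
    have "filter (\<lambda>c. c = a \<or> c = b) U = []" "filter (\<lambda>c. c = a \<or> c = b) V = []"
      using one(2,3) ab by (auto simp: filter_empty_conv)
    then have "crosses (rotate k D) a b"
      using filter_pair_distinct[OF \<open>distinct A\<close> ab] ab(3) unfolding assms(2) crosses_def by auto
    then show ?thesis using crosses_rotate rotate_inverse by metis
  qed
  moreover have "set A \<subseteq> set D" using arg_cong[OF assms(2), of set] by auto
  ultimately show ?thesis unfolding fan_def using assms(2,3) one(1) by blast
qed

section \<open>Uniqueness of the maximal fan through a chord\<close>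

lemma cyclic_two_occurrences:
  assumes "rotate k (c # P @ c # Q) = c # P' @ c # Q'"
    "c \<notin> set P" "c \<notin> set Q" "c \<notin> set P'" "c \<notin> set Q'"
  shows "P' = P \<and> Q' = Q \<or> P' = Q \<and> Q' = P"
proof -
  have eq: "R = R' \<and> S = S'"
    if "R @ c # S = R' @ c # S'" "c \<notin> set R" "c \<notin> set S" for R S R' S'
    using append_Cons_eq_iff[OF that(2,3)] that(1) by blast
  obtain u v where u: "c # P @ c # Q = u @ v" and v: "rotate k (c # P @ c # Q) = v @ u"
    by (rule rotate_split)
  show ?thesis
  proof (cases "u = [] \<or> v = []")
    case True
    then have "P @ c # Q = P' @ c # Q'" using u v assms(1) by auto
    from eq[OF this assms(2,3)] show ?thesis by simp
  next
    \<comment> \<open>A nontrivial rotation that starts with \<open>c\<close> starts at the second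
      occurrence, which exchanges the two arcs.\<close>
    case False
    then obtain u' v' where uv: "u = c # u'" "v = c # v'"
      using u v assms(1) by (cases u; cases v) auto
    then have "P @ c # Q = u' @ c # v'" "P' @ c # Q' = v' @ c # u'" using u v assms(1) by auto
    from eq[OF this(1) assms(2,3)] eq[OF this(2) assms(4,5)] show ?thesis by simp
  qed
qed

text \<open>A prefix \<open>S\<close> and a suffix \<open>T\<close> of one word are either disjoint
  or overlap; the first letter \<open>d\<close> of the overlap serves as a marker for its
  position.\<close>

lemma append_eq_append_cases:
  assumes "S @ xs = ys @ T"
  obtains (disjoint) Z where "ys = S @ Z" "xs = Z @ T"
    | (overlap) d us where "S = ys @ d # us" "T = d # us @ xs"
proof -
  consider us where "S = ys @ us" "us @ xs = T" | us where "S @ us = ys" "xs = us @ T"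
    using append_eq_append_conv2[of S xs ys T] assms by blast
  then show thesis
  proof cases
    case 1
    then show thesis using disjoint[of "[]"] overlap by (cases us) auto
  next
    case 2
    then show thesis using disjoint[of us] by simp
  qed
qed

text \<open>
  If the common prefix \<open>S\<close> and the common suffix \<open>T\<close> overlap in \<open>P\<close>, then they overlap in \<open>Q\<close> in
  the same way, as the overlap occurs only once there.
\<close>

lemma common_prefix_suffix:
  assumes P: "P = S @ P1" "P = P2 @ T" and Q: "Q = S @ Q1" "Q = Q2 @ T"
    and once: "\<And>d. d \<in> set S \<Longrightarrow> count_list P d = 1 \<and> count_list Q d = 1"
  shows "P = Q \<or> (\<exists>Z W. P = S @ Z @ T \<and> Q = S @ W @ T)"
proof -
  have eq: "P = Q" if "S = P2 @ d # us" "P = S @ P1" "T = d # us @ P1" "Q = S @ Q1" "Q = Q2 @ T"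
    "count_list Q d = 1" for P Q P2 P1 Q1 Q2 us d
  proof -
    have "count_list ((P2 @ d # us) @ Q1) d = 1" using that(6) unfolding that(4,1) .
    then have d: "d \<notin> set P2" "d \<notin> set (us @ Q1)" by (simp_all add: count_list_0_iff)
    have "P2 @ d # (us @ Q1) = Q2 @ d # (us @ P1)"
      using that(4,5) unfolding that(1,3) by simp
    then have "us @ Q1 = us @ P1" unfolding append_Cons_eq_iff[OF d] ..
    then show ?thesis using that(2,4) by simp
  qed
  have SP: "S @ P1 = P2 @ T" and SQ: "S @ Q1 = Q2 @ T"
    unfolding P(1)[symmetric] Q(1)[symmetric] by (rule P(2), rule Q(2))
  from SP show ?thesis
  proof (cases rule: append_eq_append_cases)
    case (overlap d us)
    then have "d \<in> set S" by simp
    then have "P = Q" using eq[OF overlap(1) P(1) overlap(2) Q] once by blast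
    then show ?thesis ..
  next
    case Z: (disjoint Z)
    from SQ show ?thesis
    proof (cases rule: append_eq_append_cases)
      case (overlap d us)
      then have "d \<in> set S" by simp
      then have "Q = P" using eq[OF overlap(1) Q(1) overlap(2) P] once by blast
      then show ?thesis by simp
    next
      case (disjoint W)
      then have "P = S @ Z @ T \<and> Q = S @ W @ T" using P(1) Q(1) Z(2) by simp
      then show ?thesis by blast
    qed
  qed
qed

text \<open>Split the word of the fan as \<open>T @ c # S\<close> and move the base point to
  \<open>c\<close>: the rest of the fan is then a common prefix \<open>S\<close> and a common suffix
  \<open>T\<close> of the two arcs between the endpoints of \<open>c\<close>.\<close>

lemma fan_at_chord:
  assumes "chord_diagram D" "fan D F" "c \<in> F"
  obtains k S T U V where "rotate k D = c # (S @ U @ T) @ c # (S @ V @ T)" "F = insert c (set S \<union> set T)"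
proof -
  obtain k A U V where D: "rotate k D = A @ U @ A @ V" and A: "set A = F"
    using fan_decomp[OF assms(2)] by metis
  obtain T S where TS: "A = T @ c # S" using assms(3) A split_list by metis
  have "\<exists>j. rotate j (rotate k D) = c # (S @ U @ T) @ c # (S @ V @ T)"
    unfolding D TS using rotate_append[of T "c # S @ U @ T @ c # S @ V"] by auto
  then show thesis using that[of _ S U T V] A TS unfolding rotate_rotate by auto
qed

text \<open>Both fans are common prefixes and suffixes of the same arcs \<open>P\<close> and
  \<open>Q\<close> beside \<open>c\<close>. The longer prefix and the longer suffix cover both fans;
  either they are disjoint in each arc and form a fan with \<open>c\<close>, or \<open>P = Q\<close>
  and all chords form one fan.\<close>

lemma union_fan:
  assumes D: "chord_diagram D" and F: "fan D F" "c \<in> F" and G: "fan D G" "c \<in> G"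
  obtains H where "fan D H" "F \<subseteq> H" "G \<subseteq> H"
proof -
  obtain k S T U V where kD: "rotate k D = c # (S @ U @ T) @ c # (S @ V @ T)"
    and F_eq: "F = insert c (set S \<union> set T)"
    using fan_at_chord[OF D F] .
  obtain k' S' T' U' V' where k'D: "rotate k' D = c # (S' @ U' @ T') @ c # (S' @ V' @ T')"
    and G_eq: "G = insert c (set S' \<union> set T')"
    using fan_at_chord[OF D G] .
  define P where "P = S @ U @ T"
  define Q where "Q = S @ V @ T"
  have PQ: "rotate k D = c # P @ c # Q" using kD by (simp add: P_def Q_def)
  have "count_list (rotate k D) x = 2" "count_list (rotate k' D) x = 2"
    if "x \<in> set (rotate k D)" for x
    using D that by (simp_all add: count_list_rotate chord_diagram_def)
  then have count: "count_list (c # P @ c # Q) x = 2"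
    "count_list (c # (S' @ U' @ T') @ c # (S' @ V' @ T')) x = 2" if "x \<in> set (c # P @ c # Q)" for x
    using that unfolding PQ k'D by blast+
  have c: "c \<notin> set P" "c \<notin> set Q" "c \<notin> set (S' @ U' @ T')" "c \<notin> set (S' @ V' @ T')"
    using count[of c] by (auto simp flip: count_list_0_iff)
  obtain j where "rotate j (rotate k D) = D" using rotate_inverse by metis
  then have "rotate (k' + j) (c # P @ c # Q) = c # (S' @ U' @ T') @ c # (S' @ V' @ T')"
    using k'D PQ rotate_rotate[of k' j] by metis
  then have alt: "S' @ U' @ T' = P \<and> S' @ V' @ T' = Q \<or> S' @ U' @ T' = Q \<and> S' @ V' @ T' = P"
    by (rule cyclic_two_occurrences[OF _ c])
  \<comment> \<open>If \<open>P\<close> and \<open>Q\<close> are exchanged, so are \<open>U'\<close>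
    and \<open>V'\<close>, while \<open>S'\<close> and \<open>T'\<close> belong to both arcs
    anyway.\<close>
  then obtain X Y where XY: "P = S' @ X @ T'" "Q = S' @ Y @ T'" by metis
  define S'' where "S'' = (if length S \<le> length S' then S' else S)"
  define T'' where "T'' = (if length T \<le> length T' then T' else T)"
  \<comment> \<open>Prefixes of one word are nested by length; reversal makes suffixes into
    prefixes.\<close>
  have "set (take i R) \<subseteq> set (take j R)" if "i \<le> j" for i j and R :: "'a list"
    using set_take_subset_set_take that .
  note take = this[of "length S" "length S'" P] this[of "length S'" "length S" P]
    this[of "length T" "length T'" "rev P"] this[of "length T'" "length T" "rev P"]
  have "take (length S) P = S" by (simp add: P_def)
  moreover have "take (length S') P = S'" by (simp add: XY(1))
  moreover have "take (length T) (rev P) = rev T" by (simp add: P_def)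
  moreover have "take (length T') (rev P) = rev T'" by (simp add: XY(1))
  ultimately have "set S \<subseteq> set S''" "set S' \<subseteq> set S''" "set T \<subseteq> set T''" "set T' \<subseteq> set T''"
    using take by (simp_all add: S''_def T''_def)
  then have sub: "F \<subseteq> insert c (set S'' \<union> set T'')" "G \<subseteq> insert c (set S'' \<union> set T'')"
    using F_eq G_eq by auto
  have "\<exists>P1 Q1. P = S @ P1 \<and> Q = S @ Q1" "\<exists>P1 Q1. P = S' @ P1 \<and> Q = S' @ Q1"
    using P_def Q_def XY by blast+
  then obtain P1 Q1 where pre: "P = S'' @ P1" "Q = S'' @ Q1"
    unfolding S''_def by (cases "length S \<le> length S'") auto
  have "P = (S @ U) @ T" "Q = (S @ V) @ T" "P = (S' @ X) @ T'" "Q = (S' @ Y) @ T'"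
    using P_def Q_def XY by (simp_all only: append_assoc)
  then have "\<exists>P2 Q2. P = P2 @ T \<and> Q = Q2 @ T" "\<exists>P2 Q2. P = P2 @ T' \<and> Q = Q2 @ T'"
    by blast+
  then obtain P2 Q2 where suf: "P = P2 @ T''" "Q = Q2 @ T''"
    unfolding T''_def by (cases "length T \<le> length T'") auto
  \<comment> \<open>A chord of \<open>S''\<close> meets both \<open>P\<close> and \<open>Q\<close>,
    which exhausts its two endpoints.\<close>
  have once: "count_list P d = 1 \<and> count_list Q d = 1" if "d \<in> set S''" for d
  proof -
    have "d \<in> set P" "d \<in> set Q" using pre that by auto
    then have "count_list P d > 0" "count_list Q d > 0" "d \<noteq> c"
      using c by (auto simp: count_list_0_iff intro: gr0I)
    moreover have "count_list (c # P @ c # Q) d = 2" using count(1)[of d] \<open>d \<in> set P\<close> by simp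
    ultimately show ?thesis by simp
  qed
  have "P = Q \<or> (\<exists>Z W. P = S'' @ Z @ T'' \<and> Q = S'' @ W @ T'')"
    using common_prefix_suffix[OF pre(1) suf(1) pre(2) suf(2)] once by blast
  then show thesis
  proof (elim disjE exE conjE)
    assume "P = Q"
    then have "fan D (set (c # P))"
      by (intro fanI[OF D, of k _ "[]" "[]"]) (simp_all add: PQ)
    moreover have "insert c (set S'' \<union> set T'') \<subseteq> set (c # P)"
      using arg_cong[OF pre(1), of set] arg_cong[OF suf(1), of set] by auto
    ultimately show thesis using that sub by (meson subset_trans)
  next
    fix Z W assume ZW: "P = S'' @ Z @ T''" "Q = S'' @ W @ T''"
    \<comment> \<open>Moving the final \<open>T''\<close> to the front makes
      \<open>T'' @ c # S''\<close> appear twice.\<close>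
    let ?L = "c # S'' @ Z @ T'' @ c # S'' @ W"
    obtain i where i: "rotate i (?L @ T'') = T'' @ ?L" using rotate_append by blast
    have "rotate (i + k) D = (T'' @ c # S'') @ Z @ (T'' @ c # S'') @ W"
      unfolding rotate_rotate[symmetric] PQ ZW using i by simp
    then have "fan D (set (T'' @ c # S''))" by (intro fanI[OF D]) auto
    moreover have "set (T'' @ c # S'') = insert c (set S'' \<union> set T'')" by auto
    ultimately show thesis using that sub by metis
  qed
qed

lemma maximal_fan_unique:
  assumes "chord_diagram D" "maximal_fan D F" "maximal_fan D G" "c \<in> F" "c \<in> G"
  shows "F = G"
proof -
  obtain H where "fan D H" "F \<subseteq> H" "G \<subseteq> H"
    using union_fan[of D F c G] assms unfolding maximal_fan_def by blast
  then show ?thesis using assms(2,3) unfolding maximal_fan_def by blast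
qed

section \<open>Amalgamation\<close>

text \<open>Blocks that share a chord have the same chords by uniqueness of the maximal fan. At
  different places they are the two arcs of that fan, so crossing gives them the same order. Hence a
  block can itself serve as the label of its fan.\<close>

lemma blocks_eq:
  assumes D: "chord_diagram D" "rotate k D = concat Bs"
    and Bs: "\<And>B. B \<in> set Bs \<Longrightarrow> distinct B \<and> maximal_fan D (set B)"
    and B: "B \<in> set Bs" "B' \<in> set Bs" "x \<in> set B" "x \<in> set B'"
  shows "B = B'"
proof -
  have eq: "C = C'" if "Bs = Xs @ C # Ys @ C' # Zs" "set C = set C'" for C C' Xs Ys Zs
  proof (rule crossing_arcs_eq[of k D "concat Xs" C "concat Ys" C' "concat Zs"])
    have "fan D (set C)" using Bs[of C] that(1) by (simp add: maximal_fan_def)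
    then show "crosses D a b" if "a \<in> set C" "b \<in> set C" "a \<noteq> b" for a b
      using that unfolding fan_def by blast
  qed (use Bs[of C] Bs[of C'] D(2) that in auto)
  have same: "set B = set B'" using maximal_fan_unique[OF D(1)] Bs B by blast
  obtain Xs Ys where XY: "Bs = Xs @ B # Ys" using split_list[OF B(1)] by blast
  then consider "B' = B" | "B' \<in> set Xs" | "B' \<in> set Ys" using B(2) by auto
  then show ?thesis
  proof cases
    case 2
    then obtain Us Vs where "Xs = Us @ B' # Vs" using split_list by metis
    then show ?thesis using eq[of Us B' Vs B Ys] XY same by simp
  next
    case 3
    then obtain Us Vs where "Ys = Us @ B' # Vs" using split_list by metis
    then show ?thesis using eq[of Xs B Us B' Vs] XY same by simp
  qed simp
qed

text \<open>
  From \<open>concat Bs\<close> to \<open>Bs\<close>, all chords but the first one of every block are deleted; conversely,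
  every chord of \<open>Bs\<close> is replaced by the parallel chords of the block.
\<close>

lemma cut_into_concat:
  assumes dist: "\<And>B. B \<in> set Bs \<Longrightarrow> distinct B \<and> B \<noteq> []"
    and eq: "\<And>B B' x. B \<in> set Bs \<Longrightarrow> B' \<in> set Bs \<Longrightarrow> x \<in> set B \<Longrightarrow> x \<in> set B' \<Longrightarrow> B = B'"
  shows "cut_into m (concat Bs) \<longleftrightarrow> cut_into m Bs"
proof
  assume "cut_into m Bs"
  then show "cut_into m (concat Bs)"
    using cut_into_concat_map[of m Bs "\<lambda>B. B"] dist eq by (simp add: disjoint_iff) blast
next
  assume cut: "cut_into m (concat Bs)"
  have hd: "hd B \<in> set B" if "B \<in> set Bs" for B using dist[OF that] by simp
  then have inj: "inj_on hd (set Bs)" using eq by (intro inj_onI) metis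
  define g where "g x = (if x \<in> hd ` set Bs then [inv_into (set Bs) hd x] else [])" for x
  have g_hd: "g (hd B) = [B]" if "B \<in> set Bs" for B
    using that inj by (simp add: g_def)
  \<comment> \<open>No later entry of a block is the head of a block, since blocks that share a
    chord coincide and their entries are distinct.\<close>
  have g_tl: "g x = []" if B: "B \<in> set Bs" "x \<in> set (tl B)" for B x
  proof -
    have "x \<noteq> hd B'" if "B' \<in> set Bs" for B'
    proof
      assume x: "x = hd B'"
      have "x \<in> set B" using dist[OF B(1)] B(2) by (auto intro: list.set_sel(2))
      have "x \<noteq> hd B" using dist[OF B(1)] B(2) by (cases B) auto
      then show False using \<open>x \<in> set B\<close> eq[OF that B(1), of x] hd[OF that] x by blast
    qed
    then show ?thesis by (auto simp: g_def)
  qed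
  have "concat (map g B) = [B]" if "B \<in> set Bs" for B
  proof -
    have "concat (map g (hd B # tl B)) = [B]"
      using g_hd[OF that] g_tl[OF that] by simp
    then show ?thesis using dist[OF that] by simp
  qed
  then have "concat (map (\<lambda>B. concat (map g B)) Bs) = Bs"
    by (induction Bs) simp_all
  moreover have "concat (map g (concat Bs)) = concat (map (\<lambda>B. concat (map g B)) Bs)"
    by (induction Bs) simp_all
  moreover have "cut_into m (concat (map g (concat Bs)))"
    by (rule cut_into_concat_map[OF cut]) (auto simp: g_def dest: inv_into_injective)
  ultimately show "cut_into m Bs" by simp
qed

theorem corollary3p5:
  fixes D :: "'a list" and D\<^sub>a :: "'b list"
  assumes "chord_diagram D"
    and "amalgamation D D\<^sub>a"
  shows "braid_index D = braid_index D\<^sub>a"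
proof -
  obtain k Bs where D: "rotate k D = concat Bs"
    and Bs: "\<And>B. B \<in> set Bs \<Longrightarrow> distinct B \<and> maximal_fan D (set B)"
    and same: "same_diagram (map set Bs) D\<^sub>a"
    using assms(2) unfolding amalgamation_def by blast
  obtain j f where f: "inj_on f (set (map set Bs))" and Da: "D\<^sub>a = map f (rotate j (map set Bs))"
    using same unfolding same_diagram_def by blast
  have ne: "B \<noteq> []" if "B \<in> set Bs" for B
    using Bs[OF that] by (auto simp: maximal_fan_def fan_def)
  have eq: "B = B'" if "B \<in> set Bs" "B' \<in> set Bs" "x \<in> set B" "x \<in> set B'" for B B' x
    using blocks_eq[OF assms(1) D Bs that] .
  have "inj_on set (set Bs)"
    using eq ne by (intro inj_onI) (metis hd_in_set)
  then have inj: "inj_on (f \<circ> set) (set Bs)" using f by (simp add: comp_inj_on)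
  have Da': "D\<^sub>a = map (f \<circ> set) (rotate j Bs)" using Da by (simp add: rotate_map)
  \<comment> \<open>Base points and names do not affect cuttings, which leaves the comparison of
    \<open>concat Bs\<close> with \<open>Bs\<close>.\<close>
  have cut: "cut_into m D \<longleftrightarrow> cut_into m D\<^sub>a" for m
    using cut_into_concat[of Bs m] cut_into_rotate[of m k D] cut_into_rotate[of m j Bs]
      cut_into_map[of "f \<circ> set" "rotate j Bs" m] inj Bs ne eq D Da' by auto
  have "chord_diagram D\<^sub>a"
    unfolding chord_diagram_def
  proof
    fix y assume "y \<in> set D\<^sub>a"
    then obtain B where B: "B \<in> set Bs" "y = f (set B)" using Da' by auto
    have hd: "hd B \<in> set B" using ne B by simp
    \<comment> \<open>The chord \<open>y\<close> has as many endpoints as \<open>B\<close> has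
      occurrences in \<open>Bs\<close>, and \<open>hd B\<close> meets exactly those blocks, once
      each.\<close>
    have "count_list D\<^sub>a y = count_list (rotate j (map (f \<circ> set) Bs)) y"
      by (simp add: Da' rotate_map)
    also have "\<dots> = count_list (map (f \<circ> set) Bs) y" by (rule count_list_rotate)
    also have "\<dots> = count_list Bs B"
      using inj B count_list_inj_map[of "f \<circ> set" Bs B] by simp
    also have "\<dots> = count_list (concat Bs) (hd B)"
    proof -
      have "count_list C (hd B) = (if C = B then 1 else 0)" if "C \<in> set Bs" for C
        using eq[OF that B(1) _ hd] hd Bs[OF that] by (auto simp: count_list_distinct)
      then show ?thesis by (induction Bs) auto
    qed
    also have "\<dots> = 2"
    proof -
      have "hd B \<in> set (rotate k D)" unfolding D using hd B(1) by auto
      then show ?thesis using assms(1) by (simp flip: D add: count_list_rotate chord_diagram_def)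
    qed
    finally show "count_list D\<^sub>a y = 2" .
  qed
  then show ?thesis by (simp add: braid_index_conv assms(1) cut)
qed

end
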